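(* For every fixed integer $k>0$ and every integer $l\geq 2$ there exists a constant $\mathcal{C}=\mathcal{C}(k)>0$ such that, as $x\to\infty$, $$\sum_{n\leq x}d_l(n)d_l(n+k)\geq (1+o(1))\left(\frac{1}{(l-1)!}\right)\left(1-\frac{1}{2(l-1)!}\right)\frac{x\log^{2(l-1)}x}{\mathcal{C}(k)}.$$
   Context: $d_l(n)=\sum_{n_1n_2\cdots n_l=n}1$ is the number of ordered $l$-tuples $(n_1,\dots,n_l)$ of positive integers with product $n$. $\log^{a}x=(\log x)^a$. The sum is over positive integers $n$, and $o(1)$ denotes a quantity tending to $0$ as $x\to\infty$. The constant $\mathcal{C}(k)$ may depend on the arithmetic function $d_l$ as well as on $k$. *)

theory Defs
  imports Complex_Main "HOL-Library.Landau_Symbols"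
begin

definition divisor_fun :: "nat \<Rightarrow> nat \<Rightarrow> nat" where
  "divisor_fun l n =
     card {ns :: nat list. length ns = l \<and> (\<forall>m\<in>set ns. 0 < m) \<and> prod_list ns = n}"

end

theory Submission
  imports Defs "HOL-Library.FuncSet" "HOL-Number_Theory.Cong" "HOL-Analysis.Harmonic_Numbers"
begin

text \<open>
  Since the constant is at our disposal, only the order of magnitude matters. With \<open>m = l - 1\<close>, the
  number \<open>d\<^sub>l(n)\<close> is the number of \<open>m\<close>-tuples whose product divides \<open>n\<close>, so the sum
  dominates the number of triples \<open>(n, a, b)\<close> in which \<open>a\<close> and \<open>b\<close> are \<open>m\<close>-tuples with entries at
  most \<open>N = x\<^bsup>1/(2m)\<^esup>\<close>, with coprime products \<open>A\<close> and \<open>B\<close>, and \<open>A\<close> divides \<open>n\<close>, \<open>B\<close> divides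
  \<open>n + k\<close>. By the Chinese remainder theorem each \<open>(a, b)\<close> contributes at least \<open>x / (2AB)\<close>.
  Without the coprimality condition, the sum of \<open>1 / (AB)\<close> is the \<open>2m\<close>-th power of a harmonic
  number. Imposing coprimality of one pair \<open>(a\<^sub>i, b\<^sub>j)\<close> costs at most a factor \<open>2\<close>: dividing
  both entries by their gcd \<open>g\<close> multiplies the weight \<open>1 / (AB)\<close> by \<open>g\<^sup>2\<close>, the tuple is
  recovered from \<open>g\<close> and its reduction, and the sum of \<open>1 / g\<^sup>2\<close> is at most \<open>2\<close>.
\<close>

section \<open>Weighted tuples under coprimality conditions\<close>

definition coprime_tuples :: "nat \<Rightarrow> 'i set \<Rightarrow> ('i \<times> 'i) set \<Rightarrow> ('i \<Rightarrow> nat) set" where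
  "coprime_tuples N I P = {f \<in> I \<rightarrow>\<^sub>E {1..N}. \<forall>(i, j)\<in>P. coprime (f i) (f j)}"

lemma finite_coprime_tuples: "finite I \<Longrightarrow> finite (coprime_tuples N I P)"
  unfolding coprime_tuples_def by (simp add: finite_PiE)

text \<open>The terms telescope; keeping \<open>- 1 / real N\<close> lets the induction close. For
  \<open>N = 0\<close> the convention 1/0 = 0 applies.\<close>

lemma sum_inverse_squares_le: "(\<Sum>g=1..N. 1 / real g ^ 2) \<le> 2 - 1 / real N"
proof (induction N)
  case (Suc N)
  show ?case
  proof (cases "N = 0")
    case False
    have "1 / real (Suc N) ^ 2 \<le> 1 / (real N * real (Suc N))"
      using False by (intro divide_left_mono) (auto simp: power2_eq_square)
    also have "\<dots> = 1 / real N - 1 / real (Suc N)"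
      using False by (simp add: field_simps)
    finally show ?thesis using Suc by simp
  qed simp
qed simp

text \<open>Reducing entries \<open>i\<close> and \<open>j\<close> by their gcd replaces entries by
  divisors, so conditions already in \<open>P\<close> survive. This is why pairs can be imposed one
  at a time.\<close>

lemma sum_coprime_tuples_insert:
  assumes "finite I" "i \<in> I" "j \<in> I" "i \<noteq> j"
  shows "(\<Sum>f\<in>coprime_tuples N I P. \<Prod>t\<in>I. 1 / real (f t))
    \<le> 2 * (\<Sum>f\<in>coprime_tuples N I (insert (i, j) P). \<Prod>t\<in>I. 1 / real (f t))"
proof -
  let ?w = "\<lambda>f. \<Prod>t\<in>I. 1 / real (f t)"
  let ?T = "coprime_tuples N I P" and ?T' = "coprime_tuples N I (insert (i, j) P)"
  define red where "red f = f(i := f i div gcd (f i) (f j), j := f j div gcd (f i) (f j))"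
    for f :: "'a \<Rightarrow> nat"
  define F where "F f = (gcd (f i) (f j), red f)" for f :: "'a \<Rightarrow> nat"
  have pos: "0 < f t" and le: "f t \<le> N" if "f \<in> ?T" "t \<in> I" for f t
    using that by (auto simp: coprime_tuples_def PiE_def Pi_def Suc_le_eq)
  have inj: "inj_on F ?T"
  proof (rule inj_onI)
    fix f h assume fh: "f \<in> ?T" "h \<in> ?T" "F f = F h"
    then have g: "gcd (f i) (f j) = gcd (h i) (h j)" and r: "red f = red h"
      by (auto simp: F_def)
    \<comment> \<open>Reduction is undone by multiplying entries \<open>i\<close> and
      \<open>j\<close> by the shared gcd.\<close>
    have "f t = h t" for t
    proof -
      have "f t = (if t = i \<or> t = j then gcd (f i) (f j) * red f t else red f t)" for f
        using assms(4) by (simp add: red_def)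
      then show ?thesis using g r by metis
    qed
    then show "f = h" by blast
  qed
  have img: "F ` ?T \<subseteq> {1..N} \<times> ?T'"
  proof
    fix z assume "z \<in> F ` ?T"
    then obtain f where f: "f \<in> ?T" and z: "z = F f" by blast
    have g: "1 \<le> gcd (f i) (f j)" "gcd (f i) (f j) \<le> N"
      using pos[OF f assms(2)] le[OF f assms(2)]
      by (auto simp: Suc_le_eq intro: order_trans[OF gcd_le1_nat])
    have dvd: "red f t dvd f t" for t
      by (simp add: red_def) (metis dvd_div_mult_self dvd_triv_left gcd_dvd1 gcd_dvd2 gcd_nat.refl)
    have "red f t \<in> {1..N}" if "t \<in> I" for t
    proof -
      have "red f t \<le> f t" using dvd pos[OF f that] by (intro dvd_imp_le)
      moreover have "red f t \<noteq> 0" using dvd[of t] pos[OF f that] by (intro notI) simp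
      ultimately show ?thesis using le[OF f that] by simp
    qed
    moreover have "red f t = undefined" if "t \<notin> I" for t
      using that assms f by (auto simp: red_def coprime_tuples_def PiE_def extensional_def)
    ultimately have "red f \<in> I \<rightarrow>\<^sub>E {1..N}" by (auto simp: PiE_def extensional_def)
    moreover have "coprime (red f p) (red f q)" if "(p, q) \<in> P" for p q
      using that f coprime_divisors[OF dvd dvd] by (auto simp: coprime_tuples_def)
    moreover have "coprime (red f i) (red f j)"
      using assms(4) pos[OF f assms(2)] by (simp add: red_def div_gcd_coprime)
    ultimately have "red f \<in> ?T'" by (auto simp: coprime_tuples_def)
    then show "z \<in> {1..N} \<times> ?T'" using g z by (auto simp: F_def)
  qed
  \<comment> \<open>Entries \<open>i\<close> and \<open>j\<close> each contribute a factor 1/g; all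
    others are unchanged.\<close>
  have w: "?w f = (\<lambda>(g, h). 1 / real g ^ 2 * ?w h) (F f)" if "f \<in> ?T" for f
  proof -
    let ?g = "gcd (f i) (f j)"
    have split: "?w h = 1 / real (h i) * (1 / real (h j) * (\<Prod>t\<in>I - {i} - {j}. 1 / real (h t)))" for h
      using assms prod.remove[of I i "\<lambda>t. 1 / real (h t)"] prod.remove[of "I - {i}" j "\<lambda>t. 1 / real (h t)"]
      by simp
    have "(\<Prod>t\<in>I - {i} - {j}. 1 / real (red f t)) = (\<Prod>t\<in>I - {i} - {j}. 1 / real (f t))"
      by (intro prod.cong) (auto simp: red_def)
    moreover have "real (f i) = real ?g * real (red f i)" "real (f j) = real ?g * real (red f j)"
      using assms(4) by (simp_all add: red_def flip: of_nat_mult)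
    ultimately show ?thesis
      unfolding split[of f] F_def by (simp add: split[of "red f"] power2_eq_square)
  qed
  have "sum ?w ?T = (\<Sum>z\<in>F ` ?T. (\<lambda>(g, h). 1 / real g ^ 2 * ?w h) z)"
    using w by (simp add: sum.reindex[OF inj])
  also have "\<dots> \<le> (\<Sum>z\<in>{1..N} \<times> ?T'. (\<lambda>(g, h). 1 / real g ^ 2 * ?w h) z)"
    by (intro sum_mono2 img) (auto simp: finite_coprime_tuples assms(1) intro!: prod_nonneg divide_nonneg_nonneg)
  also have "\<dots> = (\<Sum>g=1..N. 1 / real g ^ 2) * sum ?w ?T'"
    unfolding sum_product sum.cartesian_product ..
  also have "\<dots> \<le> 2 * sum ?w ?T'"
    using sum_inverse_squares_le[of N] by (intro mult_right_mono sum_nonneg prod_nonneg)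
      (auto intro: order_trans)
  finally show ?thesis .
qed

text \<open>With \<open>P\<close> empty, expanding the power of the harmonic sum gives equality;
  each further pair costs a factor 2. A diagonal pair would force an entry to be 1, so these are
  excluded.\<close>

lemma sum_coprime_tuples_ge:
  assumes "finite I" "finite P" "P \<subseteq> I \<times> I" "\<And>i. (i, i) \<notin> P"
  shows "harm N ^ card I
    \<le> 2 ^ card P * (\<Sum>f\<in>coprime_tuples N I P. \<Prod>t\<in>I. 1 / real (f t))"
  using assms(2-4)
proof (induction P rule: finite_induct)
  case empty
  have "harm N ^ card I = (\<Prod>t\<in>I. \<Sum>n\<in>{1..N}. 1 / real n)"
    by (simp add: harm_def inverse_eq_divide)
  also have "\<dots> = (\<Sum>f\<in>I \<rightarrow>\<^sub>E {1..N}. \<Prod>t\<in>I. 1 / real (f t))"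
    by (intro prod_sum_PiE assms(1)) simp
  finally show ?case by (simp add: coprime_tuples_def)
next
  case (insert p P)
  obtain i j where p: "p = (i, j)" by (cases p)
  have ij: "i \<in> I" "j \<in> I" "i \<noteq> j" using insert.prems unfolding p by auto
  have "harm N ^ card I \<le> 2 ^ card P * (\<Sum>f\<in>coprime_tuples N I P. \<Prod>t\<in>I. 1 / real (f t))"
    using insert by blast
  also have "\<dots> \<le> 2 ^ card P * (2 * (\<Sum>f\<in>coprime_tuples N I (insert p P). \<Prod>t\<in>I. 1 / real (f t)))"
    unfolding p by (intro mult_left_mono sum_coprime_tuples_insert ij assms(1)) simp
  finally show ?case using insert by (simp add: mult.assoc mult.left_commute)
qed

section \<open>Tuples and the divisor function\<close>

lemma finite_factorizations:
  assumes "n > 0"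
  shows "finite {ns :: nat list. length ns = l \<and> (\<forall>m\<in>set ns. 0 < m) \<and> prod_list ns = n}"
proof (rule finite_subset)
  show "{ns :: nat list. length ns = l \<and> (\<forall>m\<in>set ns. 0 < m) \<and> prod_list ns = n}
    \<subseteq> {ns. set ns \<subseteq> {..n} \<and> length ns = l}"
    using assms by (auto intro!: dvd_imp_le prod_list_dvd)
qed (intro finite_lists_length_eq finite_atMost)

text \<open>Appending the cofactor \<open>n div prod f I\<close> completes a tuple to a
  factorization of \<open>n\<close>, and the tuple remains visible in its first entries.\<close>

lemma card_tuples_le_divisor_fun:
  assumes "finite I" "n > 0"
  shows "card {f \<in> I \<rightarrow>\<^sub>E {1..N}. prod f I dvd n} \<le> divisor_fun (Suc (card I)) n"
proof -
  obtain xs where xs: "distinct xs" "set xs = I" using assms(1) finite_distinct_list by blast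
  let ?F = "\<lambda>f. map f xs @ [n div prod f I]"
  have len: "length xs = card I" using distinct_card[OF xs(1)] xs(2) by simp
  have prod: "prod_list (map f xs) = prod f I" for f :: "'a \<Rightarrow> nat"
    using prod.distinct_set_conv_list[OF xs(1), of f] xs(2) by simp
  show ?thesis unfolding divisor_fun_def
  proof (rule card_inj_on_le[of ?F])
    show "inj_on ?F {f \<in> I \<rightarrow>\<^sub>E {1..N}. prod f I dvd n}"
    proof (rule inj_onI, goal_cases)
      case (1 f g)
      then have "f t = g t" if "t \<in> I" for t using xs(2) that by simp
      with 1 show ?case by (intro PiE_ext[of f I "\<lambda>_. {1..N}" g]) simp_all
    qed
    show "?F ` {f \<in> I \<rightarrow>\<^sub>E {1..N}. prod f I dvd n} \<subseteq>
      {ns. length ns = Suc (card I) \<and> (\<forall>m\<in>set ns. 0 < m) \<and> prod_list ns = n}"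
    proof clarify
      fix f assume f: "f \<in> I \<rightarrow>\<^sub>E {1..N}" "prod f I dvd n"
      have "\<forall>t\<in>I. 0 < f t" using f(1) by (auto simp: PiE_iff Suc_le_eq)
      moreover have "0 < n div prod f I"
        using f(2) assms(2) by (auto elim!: dvdE)
      moreover have "prod f I * (n div prod f I) = n" using f(2) by simp
      ultimately show "length (?F f) = Suc (card I) \<and> (\<forall>m\<in>set (?F f). 0 < m) \<and> prod_list (?F f) = n"
        using xs by (auto simp: len prod)
    qed
  qed (rule finite_factorizations[OF assms(2)])
qed

text \<open>The two divisibilities select one residue class modulo \<open>A * B\<close>, with at
  least floor(x / (A B)) positive members up to \<open>x\<close>.\<close>

lemma card_coprime_dvd_shift_ge:
  assumes "coprime A B" "0 < A" "0 < B" "real (A * B) \<le> x"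
  shows "x / (2 * real (A * B)) \<le> real (card {n. 0 < n \<and> real n \<le> x \<and> A dvd n \<and> B dvd n + k})"
proof -
  let ?S = "{n. 0 < n \<and> real n \<le> x \<and> A dvd n \<and> B dvd n + k}"
  define M where "M = A * B"
  define q where "q = nat \<lfloor>x / real M\<rfloor>"
  have M: "0 < M" using assms by (simp add: M_def)
  have x: "1 \<le> x / real M" using M assms(4) by (simp add: M_def)
  \<comment> \<open>The solution sought is n = u + 1, which places it in \<open>{1..M}\<close> and
    not at 0. The residues are -1 and -(k + 1), the latter raised by \<open>B * Suc k\<close> to
    stay in the naturals.\<close>
  have "\<exists>u. u < A * B \<and> [u = A - 1] (mod A) \<and> [u = B * Suc k - Suc k] (mod B)"
    using binary_chinese_remainder_unique_nat[OF assms(1)] assms(2,3) by blast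
  then obtain u where u: "u < M" "[u = A - 1] (mod A)" "[u = B * Suc k - Suc k] (mod B)"
    unfolding M_def by blast
  have "[u + 1 = A - 1 + 1] (mod A)" using u(2) by (intro cong_add) auto
  then have uA: "A dvd u + 1" using assms(2) by (simp add: cong_0_iff[symmetric] cong_def)
  have "[u + Suc k = B * Suc k - Suc k + Suc k] (mod B)" using u(3) by (intro cong_add) auto
  moreover have "B * Suc k - Suc k + Suc k = B * Suc k"
    using mult_le_mono1[of 1 B "Suc k"] assms(3) by (intro le_add_diff_inverse2) simp
  ultimately have uB: "B dvd u + Suc k" by (metis cong_dvd_iff dvd_triv_left)
  have "(\<lambda>t. u + 1 + M * t) ` {..<q} \<subseteq> ?S"
  proof clarify
    fix t assume "t < q"
    then have "M * Suc t \<le> M * q" by (intro mult_le_mono) auto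
    then have "u + 1 + M * t \<le> M * q" using u(1) by simp
    then have "real (u + 1 + M * t) \<le> real M * real q" by (metis of_nat_le_iff of_nat_mult)
    also have "real q \<le> x / real M" using x by (simp add: q_def)
    then have "real M * real q \<le> x" using M by (simp add: field_simps)
    finally have "real (u + 1 + M * t) \<le> x" .
    moreover have "A dvd u + 1 + M * t" by (intro dvd_add[OF uA]) (simp add: M_def)
    moreover have "B dvd (u + Suc k) + M * t" by (intro dvd_add[OF uB]) (simp add: M_def)
    then have "B dvd u + 1 + M * t + k" by (simp add: ac_simps)
    ultimately show "0 < u + 1 + M * t \<and> real (u + 1 + M * t) \<le> x
      \<and> A dvd u + 1 + M * t \<and> B dvd u + 1 + M * t + k" by simp
  qed
  moreover have "finite ?S"
    by (rule finite_subset[of _ "{..nat \<lfloor>x\<rfloor>}"]) (auto intro: le_nat_floor)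
  moreover have "inj_on (\<lambda>t. u + 1 + M * t) {..<q}" using M by (auto simp: inj_on_def)
  ultimately have "q \<le> card ?S" using card_inj_on_le[of _ "{..<q}" ?S] by auto
  \<comment> \<open>Here r < floor(r) + 1 \<le> 2 floor(r).\<close>
  moreover have "r / 2 \<le> real (nat \<lfloor>r\<rfloor>)" if "1 \<le> r" for r :: real
  proof -
    have "1 \<le> \<lfloor>r\<rfloor>" using that by simp
    then show ?thesis using real_of_int_floor_add_one_gt[of r] by linarith
  qed
  from this[OF x] have "x / real M / 2 \<le> real q" unfolding q_def .
  ultimately show ?thesis by (simp add: M_def mult.commute)
qed

text \<open>Double counting of the pairs (n, f), where \<open>f\<close> carries the first tuple on
  \<open>I\<close> and the second on \<open>J\<close>. Only the \<open>m * m\<close> cross pairs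
  must be coprime, whence \<open>2 ^ (m * m)\<close>.\<close>

lemma sum_divisor_fun_shift_ge:
  assumes "real (N ^ (2 * m)) \<le> x"
  shows "x / 2 * (harm N ^ (2 * m) / 2 ^ (m * m))
    \<le> (\<Sum>n\<in>{n. 0 < n \<and> real n \<le> x}.
          real (divisor_fun (Suc m) n) * real (divisor_fun (Suc m) (n + k)))"
proof -
  define I where "I = {..<m}"
  define J where "J = {m..<2 * m}"
  have IJ: "finite I" "finite J" "card I = m" "card J = m" "I \<inter> J = {}"
    by (auto simp: I_def J_def)
  let ?X = "{n. 0 < n \<and> real n \<le> x}"
  let ?T = "coprime_tuples N (I \<union> J) (I \<times> J)"
  have X: "finite ?X"
    by (rule finite_subset[of _ "{..nat \<lfloor>x\<rfloor>}"]) (auto intro: le_nat_floor)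
  have T: "finite ?T" using IJ by (intro finite_coprime_tuples) auto
  \<comment> \<open>For fixed \<open>f\<close>, the product of all 2m entries is at most
    \<open>N ^ (2 * m)\<close>, hence at most \<open>x\<close>, as the progression count
    requires.\<close>
  have lower: "x / 2 * (\<Prod>t\<in>I \<union> J. 1 / real (f t))
      \<le> real (card {n\<in>?X. prod f I dvd n \<and> prod f J dvd n + k})" if "f \<in> ?T" for f
  proof -
    have f: "f t \<in> {1..N}" if "t \<in> I \<union> J" for t
      using \<open>f \<in> ?T\<close> that by (auto simp: coprime_tuples_def)
    have cop: "coprime (prod f I) (prod f J)"
      using that by (auto simp: coprime_tuples_def intro!: prod_coprime_left prod_coprime_right)
    have pos: "0 < prod f I" "0 < prod f J"
      using f by (force intro!: prod_pos)+
    have eq: "prod f I * prod f J = prod f (I \<union> J)"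
      using IJ by (simp add: prod.union_disjoint)
    have "prod f (I \<union> J) \<le> (\<Prod>t\<in>I \<union> J. N)" using f by (intro prod_mono) auto
    also have "\<dots> = N ^ (2 * m)" using IJ by (simp add: card_Un_disjoint mult_2)
    finally have "real (prod f I * prod f J) \<le> real (N ^ (2 * m))"
      unfolding eq of_nat_le_iff .
    also note assms
    finally have "real (prod f I * prod f J) \<le> x" .
    from card_coprime_dvd_shift_ge[OF cop pos this, of k]
    show ?thesis unfolding eq by (simp add: prod_dividef conj_ac)
  qed
  \<comment> \<open>For fixed \<open>n\<close>, the two restrictions determine \<open>f\<close>, and
    each is counted by one divisor function.\<close>
  have upper: "card {f\<in>?T. prod f I dvd n \<and> prod f J dvd n + k}
      \<le> divisor_fun (Suc m) n * divisor_fun (Suc m) (n + k)" if "n \<in> ?X" for n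
  proof -
    let ?A = "{f \<in> I \<rightarrow>\<^sub>E {1..N}. prod f I dvd n}" and ?B = "{f \<in> J \<rightarrow>\<^sub>E {1..N}. prod f J dvd n + k}"
    have "card {f\<in>?T. prod f I dvd n \<and> prod f J dvd n + k} \<le> card (?A \<times> ?B)"
    proof (rule card_inj_on_le[of "\<lambda>f. (restrict f I, restrict f J)"])
      show "inj_on (\<lambda>f. (restrict f I, restrict f J)) {f\<in>?T. prod f I dvd n \<and> prod f J dvd n + k}"
      proof (rule inj_onI, goal_cases)
        case (1 f g)
        then have "f t = g t" if "t \<in> I \<union> J" for t
          using that by (metis Pair_inject UnE restrict_apply')
        with 1 show ?case by (auto simp: coprime_tuples_def intro!: PiE_ext[of f "I \<union> J" "\<lambda>_. {1..N}" g])
      qed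
      show "(\<lambda>f. (restrict f I, restrict f J)) ` {f\<in>?T. prod f I dvd n \<and> prod f J dvd n + k} \<subseteq> ?A \<times> ?B"
        by (auto simp: coprime_tuples_def)
      show "finite (?A \<times> ?B)" using IJ by (intro finite_cartesian_product) (simp_all add: finite_PiE)
    qed
    also have "\<dots> \<le> divisor_fun (Suc m) n * divisor_fun (Suc m) (n + k)"
      unfolding card_cartesian_product
      using that IJ card_tuples_le_divisor_fun[of I n N] card_tuples_le_divisor_fun[of J "n + k" N]
      by (intro mult_le_mono) auto
    finally show ?thesis .
  qed
  have "harm N ^ (2 * m) \<le> 2 ^ (m * m) * (\<Sum>f\<in>?T. \<Prod>t\<in>I \<union> J. 1 / real (f t))"
    using sum_coprime_tuples_ge[of "I \<union> J" "I \<times> J" N] IJ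
    by (auto simp: card_Un_disjoint card_cartesian_product mult_2)
  then have "harm N ^ (2 * m) / 2 ^ (m * m) \<le> (\<Sum>f\<in>?T. \<Prod>t\<in>I \<union> J. 1 / real (f t))"
    by (simp add: field_simps)
  moreover have "0 \<le> x" using assms by (meson of_nat_0_le_iff order_trans)
  ultimately have "x / 2 * (harm N ^ (2 * m) / 2 ^ (m * m))
      \<le> x / 2 * (\<Sum>f\<in>?T. \<Prod>t\<in>I \<union> J. 1 / real (f t))"
    by (intro mult_left_mono) auto
  also have "\<dots> \<le> (\<Sum>f\<in>?T. real (card {n\<in>?X. prod f I dvd n \<and> prod f J dvd n + k}))"
    unfolding sum_distrib_left by (intro sum_mono lower)
  also have "\<dots> = real (\<Sum>n\<in>?X. card {f\<in>?T. prod f I dvd n \<and> prod f J dvd n + k})"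
    unfolding of_nat_sum[symmetric] of_nat_eq_iff
    by (intro sum_multicount_gen[symmetric] X T) auto
  also have "\<dots> \<le> real (\<Sum>n\<in>?X. divisor_fun (Suc m) n * divisor_fun (Suc m) (n + k))"
    unfolding of_nat_le_iff by (intro sum_mono upper)
  finally show ?thesis by simp
qed

theorem corollary4p2:
  fixes k l :: nat
  assumes "k > 0" and "l \<ge> 2"
  shows "\<exists>C :: real. C > 0 \<and>
    (\<exists>\<epsilon> :: real \<Rightarrow> real. \<epsilon> \<in> o[at_top](\<lambda>_. 1) \<and>
      (\<forall>\<^sub>F x in at_top.
        (\<Sum>n\<in>{n :: nat. 0 < n \<and> real n \<le> x}. real (divisor_fun l n) * real (divisor_fun l (n + k)))
          \<ge> (1 + \<epsilon> x) * (1 / fact (l - 1)) * (1 - 1 / (2 * fact (l - 1)))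
              * (x * ln x ^ (2 * (l - 1)) / C)))"
proof -
  define m where "m = l - 1"
  have m: "l = Suc m" "0 < m" using assms(2) by (auto simp: m_def)
  \<comment> \<open>The factors come from the floor bound, the coprimality conditions, and ln x = 2m
    ln y with y = x^(1/(2m)).\<close>
  define D :: real where "D = 2 * 2 ^ (m * m) * real (2 * m) ^ (2 * m)"
  \<comment> \<open>The numerical factor of the claim; it is positive since m! \<ge> 1, and taking C
    = \<open>c * D\<close> cancels it.\<close>
  define c :: real where "c = (1 / fact m) * (1 - 1 / (2 * fact m))"
  have fact: "1 \<le> (fact m :: real)" by (rule fact_ge_1)
  have c: "0 < c" unfolding c_def using fact by (intro mult_pos_pos) (simp_all del: fact_ge_1)
  have D: "0 < D" using m by (simp add: D_def)
  have main: "x * ln x ^ (2 * m) / D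
      \<le> (\<Sum>n\<in>{n. 0 < n \<and> real n \<le> x}. real (divisor_fun l n) * real (divisor_fun l (n + k)))"
    if x: "1 \<le> x" for x
  proof -
    define y where "y = x powr (1 / real (2 * m))"
    \<comment> \<open>The largest \<open>N\<close> with \<open>N ^ (2 * m)\<close> at most
      \<open>x\<close>; rounding down is harmless because \<open>harm N\<close> already dominates
      ln(N + 1) \<ge> ln y.\<close>
    define N where "N = nat \<lfloor>y\<rfloor>"
    have y: "0 < y" "y ^ (2 * m) = x"
      using x m by (simp_all add: y_def powr_powr flip: powr_realpow)
    have N: "real N \<le> y" "y \<le> real N + 1" using y(1) by (simp_all add: N_def)
    have "real (N ^ (2 * m)) \<le> x"
      using power_mono[OF N(1), of "2 * m"] y(2) by simp
    note le = sum_divisor_fun_shift_ge[OF this, of k]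
    have "ln x / real (2 * m) = ln y" using x by (simp add: y_def ln_powr)
    also have "\<dots> \<le> ln (real N + 1)" using y(1) N(2) by simp
    also have "\<dots> \<le> harm N" by (rule ln_le_harm)
    finally have "(ln x / real (2 * m)) ^ (2 * m) \<le> harm N ^ (2 * m)"
      using x by (intro power_mono) auto
    then have "x / 2 * ((ln x / real (2 * m)) ^ (2 * m) / 2 ^ (m * m))
        \<le> x / 2 * (harm N ^ (2 * m) / 2 ^ (m * m))"
      using x by (intro mult_left_mono divide_right_mono) auto
    moreover have "x / 2 * ((ln x / real (2 * m)) ^ (2 * m) / 2 ^ (m * m)) = x * ln x ^ (2 * m) / D"
      unfolding D_def power_divide by simp
    ultimately show ?thesis using le unfolding m(1) by linarith
  qed
  show ?thesis
  proof (intro exI conjI)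
    \<comment> \<open>The bound \<open>main\<close> holds for every x \<ge> 1, so the error term can
      be 0.\<close>
    show "0 < c * D" using c D by simp
    show "(\<lambda>_. 0) \<in> o[at_top](\<lambda>_ :: real. 1 :: real)" by simp
    show "\<forall>\<^sub>F x in at_top.
        (\<Sum>n\<in>{n. 0 < n \<and> real n \<le> x}. real (divisor_fun l n) * real (divisor_fun l (n + k)))
          \<ge> (1 + 0) * (1 / fact (l - 1)) * (1 - 1 / (2 * fact (l - 1)))
              * (x * ln x ^ (2 * (l - 1)) / (c * D))"
      using eventually_ge_at_top[of 1]
    proof eventually_elim
      case (elim x)
      have "(1 + 0) * (1 / fact (l - 1)) * (1 - 1 / (2 * fact (l - 1)))
          * (x * ln x ^ (2 * (l - 1)) / (c * D)) = c * (x * ln x ^ (2 * m) / (c * D))"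
        by (simp add: c_def m_def)
      also have "\<dots> = x * ln x ^ (2 * m) / D" using c by simp
      finally show ?case using main[OF elim] by linarith
    qed
  qed
qed

end
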